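(* Let $A\in\mathcal{B}(H)$ be a selfadjoint operator with $\operatorname{sp}(A)\subset[\gamma,\Gamma]$ for some real numbers $\gamma<\Gamma$. Let $h:[\gamma,\Gamma]\to\mathbb{R}$ be non-negative and continuous and let $f,g:[\gamma,\Gamma]\to\mathbb{R}$ be continuous. If $f$ and $g$ are $h$-synchronous on $[\gamma,\Gamma]$, then $$\begin{aligned} &h^2(\langle Ax,x\rangle)\,\langle f(A)g(A)x,x\rangle-\langle h(A)f(A)x,x\rangle\cdot\langle h(A)g(A)x,x\rangle\\ &\ \ge\ \left[h(\langle Ax,x\rangle)\,\langle h(A)f(A)x,x\rangle-\langle h^2(A)x,x\rangle\, f(\langle Ax,x\rangle)\right]\cdot g(\langle Ax,x\rangle)\\ &\quad+\left[h(\langle Ax,x\rangle)\,f(\langle Ax,x\rangle)-\langle h(A)f(A)x,x\rangle\right]\cdot\langle h(A)g(A)x,x\rangle \end{aligned}$$ for any $x\in H$ with $\|x\|=1$. If $f$ and $g$ are $h$-asynchronous on $[\gamma,\Gamma]$, then the reverse inequality ($\le$) holds for any $x\in H$ with $\|x\|=1$.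
   Context: $(H,\langle\cdot,\cdot\rangle)$ is a complex Hilbert space, $\mathcal{B}(H)$ is the algebra of bounded linear operators on $H$, and $\operatorname{sp}(A)$ is the spectrum of $A$. For a selfadjoint $A$ and a continuous function $f$ on $\operatorname{sp}(A)$, $f(A)$ is defined by the continuous functional calculus; $h^2$ is the pointwise square of $h$. Given a non-negative function $h:[a,b]\to\mathbb{R}_+$, two functions $f,g:[a,b]\to\mathbb{R}$ are called $h$-synchronous (respectively $h$-asynchronous) on $[a,b]$ if $(h(y)f(x)-h(x)f(y))(h(y)g(x)-h(x)g(y))\ge 0$ (respectively $\le 0$) for all $x,y\in[a,b]$. *)

theory Defs
  imports "HOL-Analysis.Analysis"
begin

text \<open>
  Complex Hilbert spaces. The inner product is linear in the first argument. Positive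
  definiteness of \<open>cinner\<close> follows from \<open>cinner_self\<close> and the norm axioms, and completeness is
  part of \<^class>\<open>banach\<close>.
\<close>

class complex_hilbert = banach +
  fixes scaleC :: "complex \<Rightarrow> 'a \<Rightarrow> 'a"  (infixr "*\<^sub>C" 75)
    and cinner :: "'a \<Rightarrow> 'a \<Rightarrow> complex"  ("(\<langle>_,/ _\<rangle>)")
  assumes scaleR_scaleC: "r *\<^sub>R x = complex_of_real r *\<^sub>C x"
    and scaleC_add_right: "c *\<^sub>C (x + y) = c *\<^sub>C x + c *\<^sub>C y"
    and scaleC_add_left: "(c + d) *\<^sub>C x = c *\<^sub>C x + d *\<^sub>C x"
    and scaleC_scaleC: "c *\<^sub>C (d *\<^sub>C x) = (c * d) *\<^sub>C x"
    and cinner_commute: "\<langle>x, y\<rangle> = cnj \<langle>y, x\<rangle>"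
    and cinner_add_left: "\<langle>x + y, z\<rangle> = \<langle>x, z\<rangle> + \<langle>y, z\<rangle>"
    and cinner_scaleC_left: "\<langle>c *\<^sub>C x, y\<rangle> = c * \<langle>x, y\<rangle>"
    and cinner_self: "\<langle>x, x\<rangle> = complex_of_real ((norm x)\<^sup>2)"

definition bounded_clinear :: "('a::complex_hilbert \<Rightarrow> 'a) \<Rightarrow> bool" where
  "bounded_clinear T \<longleftrightarrow> bounded_linear T \<and> (\<forall>c x. T (c *\<^sub>C x) = c *\<^sub>C T x)"

definition adjoint_pair :: "('a::complex_hilbert \<Rightarrow> 'a) \<Rightarrow> ('a \<Rightarrow> 'a) \<Rightarrow> bool" where
  "adjoint_pair T S \<longleftrightarrow> (\<forall>x y. \<langle>T x, y\<rangle> = \<langle>x, S y\<rangle>)"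

definition selfadjoint :: "('a::complex_hilbert \<Rightarrow> 'a) \<Rightarrow> bool" where
  "selfadjoint A \<longleftrightarrow> bounded_clinear A \<and> adjoint_pair A A"

definition invertible_op :: "('a::complex_hilbert \<Rightarrow> 'a) \<Rightarrow> bool" where
  "invertible_op T \<longleftrightarrow> (\<exists>S. bounded_clinear S \<and> S \<circ> T = id \<and> T \<circ> S = id)"

definition op_spectrum :: "('a::complex_hilbert \<Rightarrow> 'a) \<Rightarrow> complex set" where
  "op_spectrum A = {\<mu>. \<not> invertible_op (\<lambda>x. A x - \<mu> *\<^sub>C x)}"

text \<open>
  The continuous functional calculus of \<open>A\<close> is the isometric unital \<open>*\<close>-homomorphism \<open>\<Phi>\<close> from
  \<open>C(sp(A))\<close> into the bounded operators that sends the identity function to \<open>A\<close>. An element of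
  \<open>C(sp(A))\<close> is represented by any total function that is continuous on \<open>sp(A)\<close>; by linearity and
  isometry \<open>\<Phi> f\<close> depends only on the values of \<open>f\<close> on \<open>sp(A)\<close>, and \<open>\<Phi>\<close> maps onto the
  \<open>C*\<close>-algebra generated by \<open>A\<close> and the identity. Inserting \<open>0\<close> under the supremum only matters for
  the zero space, where \<open>sp(A)\<close> is empty.
\<close>

definition is_cont_calculus ::
    "('a::complex_hilbert \<Rightarrow> 'a) \<Rightarrow> ((complex \<Rightarrow> complex) \<Rightarrow> 'a \<Rightarrow> 'a) \<Rightarrow> bool" where
  "is_cont_calculus A \<Phi> \<longleftrightarrow>
    (let C = {f. continuous_on (op_spectrum A) f} in
      (\<forall>f\<in>C. bounded_clinear (\<Phi> f)) \<and>
      (\<forall>f\<in>C. \<forall>g\<in>C. \<forall>a b. \<Phi> (\<lambda>z. a * f z + b * g z) = (\<lambda>x. a *\<^sub>C \<Phi> f x + b *\<^sub>C \<Phi> g x)) \<and>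
      (\<forall>f\<in>C. \<forall>g\<in>C. \<Phi> (\<lambda>z. f z * g z) = \<Phi> f \<circ> \<Phi> g) \<and>
      (\<forall>f\<in>C. adjoint_pair (\<Phi> f) (\<Phi> (\<lambda>z. cnj (f z)))) \<and>
      (\<forall>f\<in>C. onorm (\<Phi> f) = Sup (insert 0 ((\<lambda>z. cmod (f z)) ` op_spectrum A))) \<and>
      \<Phi> (\<lambda>z. 1) = id \<and>
      \<Phi> (\<lambda>z. z) = A)"

definition cfc :: "('a::complex_hilbert \<Rightarrow> 'a) \<Rightarrow> (complex \<Rightarrow> complex) \<Rightarrow> 'a \<Rightarrow> 'a" where
  "cfc A f = (THE B. \<exists>\<Phi>. is_cont_calculus A \<Phi> \<and> B = \<Phi> f)"

text \<open>
  \<open>f(A)\<close> for a real function \<open>f\<close> of a real variable. The spectrum of a selfadjoint operator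
  is real, so \<open>Re z = z\<close> there.
\<close>

definition rcfc :: "('a::complex_hilbert \<Rightarrow> 'a) \<Rightarrow> (real \<Rightarrow> real) \<Rightarrow> 'a \<Rightarrow> 'a" where
  "rcfc A f = cfc A (\<lambda>z. complex_of_real (f (Re z)))"

definition synchronous_on :: "real set \<Rightarrow> (real \<Rightarrow> real) \<Rightarrow> (real \<Rightarrow> real) \<Rightarrow> (real \<Rightarrow> real) \<Rightarrow> bool" where
  "synchronous_on S h f g \<longleftrightarrow>
    (\<forall>x\<in>S. \<forall>y\<in>S. (h y * f x - h x * f y) * (h y * g x - h x * g y) \<ge> 0)"

definition asynchronous_on :: "real set \<Rightarrow> (real \<Rightarrow> real) \<Rightarrow> (real \<Rightarrow> real) \<Rightarrow> (real \<Rightarrow> real) \<Rightarrow> bool" where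
  "asynchronous_on S h f g \<longleftrightarrow>
    (\<forall>x\<in>S. \<forall>y\<in>S. (h y * f x - h x * f y) * (h y * g x - h x * g y) \<le> 0)"

text \<open>
  The value \<open>\<langle>T x, x\<rangle>\<close> as a real number. It is used only for operators \<open>T\<close> that are selfadjoint,
  for which the inner product is real.
\<close>

definition rquad :: "('a::complex_hilbert \<Rightarrow> 'a) \<Rightarrow> 'a \<Rightarrow> real" where
  "rquad T x = Re \<langle>T x, x\<rangle>"

end

theory Submission
  imports Defs "HOL-Computational_Algebra.Fundamental_Theorem_Algebra"
begin

text \<open>
  Fix a unit vector \<open>x\<close> and put \<open>s = \<langle>A x, x\<rangle>\<close>.  The map \<open>\<phi> \<mapsto> \<langle>\<phi>(A) x, x\<rangle>\<close> is a positive normalized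
  linear functional on the real continuous functions on the spectrum.  Its value at the identity is
  \<open>s\<close>, so \<open>s\<close> lies in \<open>[\<gamma>, \<Gamma>]\<close>, and synchronicity applied to \<open>t\<close> and \<open>s\<close> says that
  \<open>(h(s) f(t) - h(t) f(s)) (h(s) g(t) - h(t) g(s)) \<ge> 0\<close> for all \<open>t\<close> in the spectrum.  Applying the
  functional to this function of \<open>t\<close> and expanding (\<open>rquad_rcfc_product\<close>) gives the inequality: the
  product \<open>\<langle>h(A) f(A) x, x\<rangle> \<langle>h(A) g(A) x, x\<rangle>\<close> occurs on both sides and cancels.
  For asynchronous functions all signs are reversed.

  The operators \<open>\<phi>(A)\<close> are defined by a definite description over all continuous functional calculi,
  so most of the work is to show that there is a calculus and that it is determined on continuous
  functions.  Everything rests on the identity \<open>\<parallel>p(A)\<parallel> = sup {\<bar>p(z)\<bar> | z \<in> sp(A)}\<close> for polynomials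
  \<open>p\<close>.  The inequality \<open>\<ge>\<close> (\<open>cmod_poly_le_onorm\<close>) holds because \<open>p(z)\<close> is in the spectrum of \<open>p(A)\<close>
  and a contraction argument confines the spectrum of an operator to the disc of radius its norm.
  For \<open>\<le>\<close> (\<open>norm_poly_op_le\<close>), approximate eigenvectors show that \<open>\<parallel>P\<parallel>\<^sup>2\<close> belongs to the spectrum of
  \<open>P\<^sup>* P\<close> (\<open>onorm_square_in_spectrum\<close>); with \<open>P = p(A)\<close> the operator \<open>P\<^sup>* P\<close> is again a polynomial in
  \<open>A\<close>, and factoring polynomials over the complex numbers moves this point of its spectrum back to
  a point of the spectrum of \<open>A\<close>.

  By the identity, \<open>p\<^sub>n(A)\<close> converges whenever \<open>p\<^sub>n\<close> converges uniformly on the spectrum, which is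
  compact and real; by the Weierstrass theorem the limits \<open>limit_calculus A f\<close> exist for all continuous
  \<open>f\<close>, and the properties of a calculus pass from polynomials to the limit.  Any other calculus agrees
  with it on polynomials, hence by isometry everywhere (\<open>cont_calculus_unique\<close>).
\<close>

section \<open>Complex inner product spaces\<close>

lemma scaleC_0_left [simp]: "0 *\<^sub>C x = 0"
  using scaleR_scaleC[of 0 x] by simp

lemma scaleC_1_left [simp]: "1 *\<^sub>C x = x"
  using scaleR_scaleC[of 1 x] by simp

lemma scaleC_0_right [simp]: "c *\<^sub>C (0::'a::complex_hilbert) = 0"
  using scaleC_add_right[of c "0::'a" 0] by simp

lemma scaleC_minus_left: "(- c) *\<^sub>C x = - (c *\<^sub>C x)"
  using scaleC_add_left[of "- c" c x] by (simp add: eq_neg_iff_add_eq_0)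

lemma scaleC_minus_right: "c *\<^sub>C (- x) = - (c *\<^sub>C (x::'a::complex_hilbert))"
  using scaleC_add_right[of c "- x" x] by (simp add: eq_neg_iff_add_eq_0)

lemma scaleC_diff_left: "(c - d) *\<^sub>C x = c *\<^sub>C x - d *\<^sub>C x"
  using scaleC_add_left[of c "- d" x] by (simp add: scaleC_minus_left)

lemma scaleC_diff_right: "c *\<^sub>C (x - y) = c *\<^sub>C x - c *\<^sub>C (y::'a::complex_hilbert)"
  using scaleC_add_right[of c x "- y"] by (simp add: scaleC_minus_right)

lemma cinner_add_right: "\<langle>x, y + z\<rangle> = \<langle>x, y\<rangle> + \<langle>x, z\<rangle>"
  by (metis cinner_add_left cinner_commute complex_cnj_add)

lemma cinner_scaleC_right: "\<langle>x, c *\<^sub>C y\<rangle> = cnj c * \<langle>x, y\<rangle>"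
  by (metis cinner_scaleC_left cinner_commute complex_cnj_mult)

lemma cinner_0_left [simp]: "\<langle>0, y\<rangle> = 0"
  using cinner_scaleC_left[of 0 0 y] by simp

lemma cinner_0_right [simp]: "\<langle>x, 0\<rangle> = 0"
  using cinner_scaleC_right[of x 0 0] by simp

lemma Re_cinner_self: "Re \<langle>x, x\<rangle> = (norm x)\<^sup>2"
  by (simp add: cinner_self)

lemma norm_scaleC: "norm (c *\<^sub>C x) = cmod c * norm x"
proof (rule power2_eq_imp_eq)
  have "complex_of_real ((norm (c *\<^sub>C x))\<^sup>2)
      = c * cnj c * complex_of_real ((norm x)\<^sup>2)"
    unfolding cinner_self[symmetric] by (simp add: cinner_scaleC_left cinner_scaleC_right)
  then show "(norm (c *\<^sub>C x))\<^sup>2 = (cmod c * norm x)\<^sup>2"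
    unfolding complex_norm_square[symmetric] of_real_mult[symmetric] of_real_eq_iff
    by (simp add: power_mult_distrib)
qed simp_all

lemma norm_add_square:
  "(norm (x + y))\<^sup>2 = (norm x)\<^sup>2 + 2 * Re \<langle>x, y\<rangle> + (norm (y::'a::complex_hilbert))\<^sup>2"
proof -
  have "Re \<langle>y, x\<rangle> = Re \<langle>x, y\<rangle>"
    by (subst cinner_commute) simp
  then show ?thesis
    unfolding Re_cinner_self[symmetric] by (simp add: cinner_add_left cinner_add_right)
qed

text \<open>
  The norm is given as part of the space, so the Cauchy--Schwarz inequality for the real part is
  the triangle inequality, squared; multiplying \<open>x\<close> by a unimodular constant then makes the inner
  product real.
\<close>
lemma cmod_cinner_le: "cmod \<langle>x, y\<rangle> \<le> norm x * norm (y::'a::complex_hilbert)"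
proof -
  have re: "Re \<langle>u, y\<rangle> \<le> norm u * norm y" for u
  proof -
    have "(norm (u + y))\<^sup>2 \<le> (norm u + norm y)\<^sup>2"
      by (intro power_mono norm_triangle_ineq) simp
    then show ?thesis
      by (simp add: norm_add_square power2_sum)
  qed
  show ?thesis
  proof (cases "\<langle>x, y\<rangle> = 0")
    case False
    define c where "c = cnj \<langle>x, y\<rangle> / complex_of_real (cmod \<langle>x, y\<rangle>)"
    have "\<langle>x, y\<rangle> * cnj \<langle>x, y\<rangle> = complex_of_real (cmod \<langle>x, y\<rangle>) * complex_of_real (cmod \<langle>x, y\<rangle>)"
      unfolding complex_norm_square[symmetric] by (simp add: power2_eq_square)
    then have "c * \<langle>x, y\<rangle> = complex_of_real (cmod \<langle>x, y\<rangle>)"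
      using False by (simp add: c_def mult.commute)
    then have "cmod \<langle>x, y\<rangle> = Re \<langle>c *\<^sub>C x, y\<rangle>"
      by (simp add: cinner_scaleC_left)
    also have "\<dots> \<le> cmod c * norm x * norm y"
      using re[of "c *\<^sub>C x"] by (simp add: norm_scaleC)
    also have "cmod c = 1"
      using False by (simp add: c_def norm_divide)
    finally show ?thesis
      by simp
  qed simp
qed

lemma bounded_bilinear_cinner:
  "bounded_bilinear (cinner :: 'a::complex_hilbert \<Rightarrow> 'a \<Rightarrow> complex)"
proof
  show "\<exists>K. \<forall>x y. cmod \<langle>x, y\<rangle> \<le> norm (x::'a) * norm y * K"
    by (intro exI[of _ 1]) (simp add: cmod_cinner_le)
qed (simp_all add: cinner_add_left cinner_add_right cinner_scaleC_left cinner_scaleC_right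
    scaleR_scaleC scaleR_conv_of_real)

section \<open>Invertibility and the spectrum\<close>

lemma bounded_clinearI:
  assumes "\<And>x y. T (x + y) = T x + T y" and "\<And>c x. T (c *\<^sub>C x) = c *\<^sub>C T x"
    and "\<And>x. norm (T x) \<le> norm x * K"
  shows "bounded_clinear T"
  unfolding bounded_clinear_def
  using assms by (auto intro!: bounded_linear_intro[of _ K] simp: scaleR_scaleC)

lemma bounded_clinear_zero: "bounded_clinear (\<lambda>x. 0)"
  by (rule bounded_clinearI[of _ 0]) simp_all

lemma bounded_clinear_scaleC: "bounded_clinear (\<lambda>x. c *\<^sub>C x)"
  by (rule bounded_clinearI[of _ "cmod c"])
    (simp_all add: scaleC_add_right scaleC_scaleC norm_scaleC mult.commute)

lemma bounded_clinear_compose: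
  "bounded_clinear S \<Longrightarrow> bounded_clinear T \<Longrightarrow> bounded_clinear (\<lambda>x. S (T x))"
  unfolding bounded_clinear_def by (auto intro: bounded_linear_compose)

lemma bounded_clinear_add:
  "bounded_clinear S \<Longrightarrow> bounded_clinear T \<Longrightarrow> bounded_clinear (\<lambda>x. S x + T x)"
  unfolding bounded_clinear_def by (auto intro: bounded_linear_add simp: scaleC_add_right)

lemma bounded_clinear_const_scaleC:
  "bounded_clinear T \<Longrightarrow> bounded_clinear (\<lambda>x. c *\<^sub>C T x)"
  using bounded_clinear_compose[OF bounded_clinear_scaleC] .

lemma bounded_clinear_imp_bounded_linear: "bounded_clinear T \<Longrightarrow> bounded_linear T"
  by (simp add: bounded_clinear_def)

lemma bounded_clinear_linear:
  assumes "bounded_clinear T"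
  shows "T (x + y) = T x + T y" "T (x - y) = T x - T y" "T (c *\<^sub>C x) = c *\<^sub>C T x" "T 0 = 0"
  using assms linear_add[of T] linear_diff[of T] linear_0[of T]
  by (auto simp: bounded_clinear_def bounded_linear.linear)

lemma invertible_opE:
  assumes "invertible_op T"
  obtains S where "bounded_clinear S" "\<And>x. S (T x) = x" "\<And>x. T (S x) = x"
  using assms unfolding invertible_op_def fun_eq_iff by auto

lemma invertible_opI:
  "bounded_clinear S \<Longrightarrow> (\<And>x. S (T x) = x) \<Longrightarrow> (\<And>x. T (S x) = x) \<Longrightarrow> invertible_op T"
  unfolding invertible_op_def fun_eq_iff by auto

lemma invertible_op_compose:
  assumes "invertible_op S" "invertible_op T"
  shows "invertible_op (\<lambda>x. S (T x))"
proof -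
  obtain S' where S': "bounded_clinear S'" "\<And>x. S' (S x) = x" "\<And>x. S (S' x) = x"
    using assms(1) by (rule invertible_opE) blast
  obtain T' where T': "bounded_clinear T'" "\<And>x. T' (T x) = x" "\<And>x. T (T' x) = x"
    using assms(2) by (rule invertible_opE) blast
  show ?thesis
    by (rule invertible_opI[of "\<lambda>x. T' (S' x)"])
      (simp_all add: bounded_clinear_compose S' T')
qed

lemma invertible_op_scaleC: "c \<noteq> 0 \<Longrightarrow> invertible_op (\<lambda>x. c *\<^sub>C x)"
  by (rule invertible_opI[of "\<lambda>x. inverse c *\<^sub>C x"])
    (simp_all add: bounded_clinear_scaleC scaleC_scaleC)

text \<open>
  If \<open>Q\<close> inverts the product of commuting operators \<open>S\<close> and \<open>T\<close>, then \<open>S Q\<close> is a right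
  inverse and \<open>Q S\<close> a left inverse of \<open>T\<close>.
\<close>
lemma invertible_op_commuting_factor:
  assumes "bounded_clinear S" and comm: "\<And>x. S (T x) = T (S x)"
    and "invertible_op (\<lambda>x. S (T x))"
  shows "invertible_op T"
proof -
  obtain Q where Q: "bounded_clinear Q" "\<And>x. Q (S (T x)) = x" "\<And>x. S (T (Q x)) = x"
    using assms(3) by (rule invertible_opE) blast
  have right: "T (S (Q x)) = x" for x
    by (simp add: Q(3) flip: comm)
  then have "Q (S x) = S (Q x)" for x
    by (metis Q(2))
  then show ?thesis
    using right Q by (intro invertible_opI[of "\<lambda>x. S (Q x)"])
      (auto intro: bounded_clinear_compose assms(1))
qed

text \<open>
  The equation \<open>T x - \<mu> x = y\<close> says that \<open>x\<close> is a fixed point of \<open>x \<mapsto> (T x - y) / \<mu>\<close>, which is a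
  contraction.
\<close>
lemma invertible_op_of_onorm_less:
  assumes T: "bounded_clinear T" and less: "onorm T < cmod \<mu>"
  shows "invertible_op (\<lambda>x. T x - \<mu> *\<^sub>C x)"
proof -
  have bl: "bounded_linear T"
    using T by (rule bounded_clinear_imp_bounded_linear)
  have pos: "cmod \<mu> > 0" and nz: "\<mu> \<noteq> 0"
    using less onorm_pos_le[OF bl] by auto
  have ex: "\<exists>!x. T x - \<mu> *\<^sub>C x = y" for y
  proof -
    have "\<exists>!x. inverse \<mu> *\<^sub>C (T x - y) = x"
    proof (rule banach_fix_type[of "onorm T / cmod \<mu>"])
      show "\<forall>x z. dist (inverse \<mu> *\<^sub>C (T x - y)) (inverse \<mu> *\<^sub>C (T z - y))
              \<le> onorm T / cmod \<mu> * dist x z"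
      proof (intro allI)
        fix x z
        have "inverse \<mu> *\<^sub>C (T x - y) - inverse \<mu> *\<^sub>C (T z - y) = inverse \<mu> *\<^sub>C T (x - z)"
          by (simp add: bounded_clinear_linear[OF T] flip: scaleC_diff_right)
        then show "dist (inverse \<mu> *\<^sub>C (T x - y)) (inverse \<mu> *\<^sub>C (T z - y))
              \<le> onorm T / cmod \<mu> * dist x z"
          using onorm[OF bl, of "x - z"] pos
          by (simp add: dist_norm norm_scaleC norm_inverse divide_inverse mult_left_mono
              mult.assoc mult.left_commute[of _ "inverse (cmod \<mu>)"])
      qed
    qed (use less pos onorm_pos_le[OF bl] in auto)
    moreover have "inverse \<mu> *\<^sub>C (T x - y) = x \<longleftrightarrow> T x - \<mu> *\<^sub>C x = y" for x
    proof
      assume "inverse \<mu> *\<^sub>C (T x - y) = x"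
      then have "\<mu> *\<^sub>C inverse \<mu> *\<^sub>C (T x - y) = \<mu> *\<^sub>C x"
        by simp
      then show "T x - \<mu> *\<^sub>C x = y"
        using nz by (simp add: scaleC_scaleC algebra_simps)
    next
      assume "T x - \<mu> *\<^sub>C x = y"
      then have "T x - y = \<mu> *\<^sub>C x"
        by (simp add: algebra_simps)
      then show "inverse \<mu> *\<^sub>C (T x - y) = x"
        using nz by (simp add: scaleC_scaleC)
    qed
    ultimately show ?thesis
      by simp
  qed
  define S where "S y = (THE x. T x - \<mu> *\<^sub>C x = y)" for y
  have right: "T (S y) - \<mu> *\<^sub>C S y = y" for y
    unfolding S_def by (rule theI'[OF ex])
  have left: "S (T x - \<mu> *\<^sub>C x) = x" for x
    unfolding S_def by (rule the1_equality[OF ex]) simp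
  have uniq: "S y = x" if "T x - \<mu> *\<^sub>C x = y" for x y
    using left that by blast
  have gap: "cmod \<mu> - onorm T > 0"
    using less by simp
  have "bounded_clinear S"
  proof (rule bounded_clinearI[of _ "inverse (cmod \<mu> - onorm T)"])
    show "S (x + y) = S x + S y" for x y
      using right[of x] right[of y]
      by (intro uniq) (simp add: bounded_clinear_linear[OF T] scaleC_add_right algebra_simps)
    show "S (c *\<^sub>C x) = c *\<^sub>C S x" for c x
      using right[of x]
      by (intro uniq)
        (metis (no_types) bounded_clinear_linear(3)[OF T] scaleC_diff_right scaleC_scaleC
          mult.commute)
    show "norm (S y) \<le> norm y * inverse (cmod \<mu> - onorm T)" for y
    proof -
      have "cmod \<mu> * norm (S y) = norm (T (S y) - y)"
        using right[of y] by (simp add: algebra_simps flip: norm_scaleC)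
      also have "\<dots> \<le> onorm T * norm (S y) + norm y"
        using norm_triangle_ineq4[of "T (S y)" y] onorm[OF bl, of "S y"] by simp
      finally have "(cmod \<mu> - onorm T) * norm (S y) \<le> norm y"
        by (simp add: algebra_simps)
      then show ?thesis
        using gap by (simp add: field_simps)
    qed
  qed
  then show ?thesis
    using left right by (rule invertible_opI)
qed

lemma cmod_le_onorm_if_in_spectrum:
  assumes "bounded_clinear T" "\<mu> \<in> op_spectrum T"
  shows "cmod \<mu> \<le> onorm T"
  using invertible_op_of_onorm_less[OF assms(1), of \<mu>] assms(2)
  unfolding op_spectrum_def by force

text \<open>
  If \<open>S\<close> inverts \<open>T - \<mu>\<close>, then \<open>T - \<nu> = (T - \<mu>) (1 - (\<nu> - \<mu>) S)\<close>, and the second factor is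
  invertible when \<open>\<nu>\<close> is close to \<open>\<mu>\<close>.
\<close>
lemma closed_op_spectrum:
  assumes T: "bounded_clinear T"
  shows "closed (op_spectrum T)"
proof -
  have "open (- op_spectrum T)"
    unfolding open_contains_ball
  proof
    fix \<mu>
    assume "\<mu> \<in> - op_spectrum T"
    then have inv: "invertible_op (\<lambda>x. T x - \<mu> *\<^sub>C x)"
      by (simp add: op_spectrum_def)
    then obtain S where S: "bounded_clinear S" "\<And>x. S (T x - \<mu> *\<^sub>C x) = x"
        "\<And>x. T (S x) - \<mu> *\<^sub>C S x = x"
      by (rule invertible_opE) blast
    have bl: "bounded_linear S"
      using S(1) by (rule bounded_clinear_imp_bounded_linear)
    define r where "r = inverse (onorm S + 1)"
    have r: "r > 0" "onorm S * r < 1"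
      using onorm_pos_le[OF bl] by (auto simp: r_def field_simps)
    have "ball \<mu> r \<subseteq> - op_spectrum T"
    proof
      fix \<nu>
      assume "\<nu> \<in> ball \<mu> r"
      then have d: "cmod (\<nu> - \<mu>) < r"
        by (simp add: dist_norm norm_minus_commute)
      define \<delta> where "\<delta> = \<nu> - \<mu>"
      have "onorm (\<lambda>x. \<delta> *\<^sub>C S x) \<le> cmod \<delta> * onorm S"
      proof (rule onorm_bound)
        show "norm (\<delta> *\<^sub>C S x) \<le> cmod \<delta> * onorm S * norm x" for x
          using onorm[OF bl, of x] by (simp add: norm_scaleC mult.assoc mult_left_mono)
      qed (simp add: onorm_pos_le[OF bl])
      also have "\<dots> \<le> r * onorm S"
        using d onorm_pos_le[OF bl] by (intro mult_right_mono) (auto simp: \<delta>_def)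
      also have "\<dots> < cmod 1"
        using r by (simp add: mult.commute)
      finally have "invertible_op (\<lambda>x. \<delta> *\<^sub>C S x - 1 *\<^sub>C x)"
        by (intro invertible_op_of_onorm_less bounded_clinear_const_scaleC S(1))
      then have "invertible_op (\<lambda>x. (-1) *\<^sub>C (\<delta> *\<^sub>C S x - 1 *\<^sub>C x))"
        by (rule invertible_op_compose[OF invertible_op_scaleC, rotated]) simp
      then have "invertible_op (\<lambda>x. T ((-1) *\<^sub>C (\<delta> *\<^sub>C S x - 1 *\<^sub>C x))
                  - \<mu> *\<^sub>C ((-1) *\<^sub>C (\<delta> *\<^sub>C S x - 1 *\<^sub>C x)))"
        by (rule invertible_op_compose[OF inv])
      also have "(\<lambda>x. T ((-1) *\<^sub>C (\<delta> *\<^sub>C S x - 1 *\<^sub>C x))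
                  - \<mu> *\<^sub>C ((-1) *\<^sub>C (\<delta> *\<^sub>C S x - 1 *\<^sub>C x))) = (\<lambda>x. T x - \<nu> *\<^sub>C x)"
      proof
        fix x
        have "T (S x) = x + \<mu> *\<^sub>C S x"
          using S(3)[of x] by (simp add: algebra_simps)
        then show "T ((-1) *\<^sub>C (\<delta> *\<^sub>C S x - 1 *\<^sub>C x))
                  - \<mu> *\<^sub>C ((-1) *\<^sub>C (\<delta> *\<^sub>C S x - 1 *\<^sub>C x)) = T x - \<nu> *\<^sub>C x"
          by (simp add: bounded_clinear_linear[OF T] scaleC_diff_right scaleC_add_right
              scaleC_scaleC scaleC_minus_left scaleC_diff_left \<delta>_def algebra_simps)
      qed
      finally show "\<nu> \<in> - op_spectrum T"
        by (simp add: op_spectrum_def)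
    qed
    then show "\<exists>e>0. ball \<mu> e \<subseteq> - op_spectrum T"
      using r(1) by blast
  qed
  then show ?thesis
    by (simp add: closed_def)
qed

lemma compact_op_spectrum:
  assumes "bounded_clinear T"
  shows "compact (op_spectrum T)"
  using closed_op_spectrum[OF assms] cmod_le_onorm_if_in_spectrum[OF assms]
  by (auto simp: compact_eq_bounded_closed bounded_iff)

text \<open>
  Unit vectors \<open>x\<close> that almost attain the norm of \<open>P\<close> are approximate eigenvectors of \<open>P\<^sup>* P\<close> for
  the eigenvalue \<open>c = \<parallel>P\<parallel>\<^sup>2\<close>: since \<open>\<parallel>P\<^sup>* P x\<parallel> \<le> c\<close>, expanding the square gives
  \<open>\<parallel>P\<^sup>* P x - c x\<parallel>\<^sup>2 \<le> 2 c\<^sup>2 - 2 c \<parallel>P x\<parallel>\<^sup>2\<close>. An inverse of \<open>P\<^sup>* P - c\<close> would bound the left side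
  from below and so push \<open>\<parallel>P\<parallel>\<^sup>2\<close> strictly below \<open>c\<close>.
\<close>
lemma onorm_square_in_spectrum:
  fixes P Q :: "'a::complex_hilbert \<Rightarrow> 'a"
  assumes P: "bounded_clinear P" and Q: "bounded_clinear Q" and adj: "adjoint_pair Q P"
    and nontrivial: "\<exists>x::'a. x \<noteq> 0"
  shows "complex_of_real ((onorm P)\<^sup>2) \<in> op_spectrum (\<lambda>x. Q (P x))"
proof (rule ccontr)
  define c where "c = (onorm P)\<^sup>2"
  have bl: "bounded_linear P"
    using P by (rule bounded_clinear_imp_bounded_linear)
  have c0: "c \<ge> 0"
    by (simp add: c_def)
  have adj': "\<langle>Q u, v\<rangle> = \<langle>u, P v\<rangle>" for u v
    using adj unfolding adjoint_pair_def by blast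
  have normQ: "norm (Q u) \<le> onorm P * norm u" for u
  proof (cases "norm (Q u) = 0")
    case True
    then show ?thesis
      by (simp add: onorm_pos_le[OF bl])
  next
    case False
    have "(norm (Q u))\<^sup>2 = Re \<langle>u, P (Q u)\<rangle>"
      by (simp flip: Re_cinner_self add: adj')
    also have "\<dots> \<le> norm u * norm (P (Q u))"
      using cmod_cinner_le complex_Re_le_cmod order_trans by blast
    also have "\<dots> \<le> norm u * (onorm P * norm (Q u))"
      by (intro mult_left_mono onorm[OF bl]) simp
    finally have "norm (Q u) * norm (Q u) \<le> (onorm P * norm u) * norm (Q u)"
      by (simp add: power2_eq_square mult_ac)
    then show ?thesis
      using False by (metis mult_right_le_imp_le norm_ge_zero order_le_less)
  qed
  assume "complex_of_real ((onorm P)\<^sup>2) \<notin> op_spectrum (\<lambda>x. Q (P x))"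
  then have "invertible_op (\<lambda>x. Q (P x) - complex_of_real c *\<^sub>C x)"
    by (simp add: op_spectrum_def c_def)
  then obtain S where S: "bounded_clinear S" "\<And>x. S (Q (P x) - complex_of_real c *\<^sub>C x) = x"
    by (rule invertible_opE) blast
  \<comment> \<open>Adding \<open>1\<close> makes \<open>k\<close> positive without an argument that \<open>S\<close> is nonzero.\<close>
  define k where "k = (onorm S + 1)\<^sup>2"
  have blS: "bounded_linear S"
    using S(1) by (rule bounded_clinear_imp_bounded_linear)
  have k: "k > 0"
    using onorm_pos_le[OF blS] by (simp add: k_def)
  have key: "(norm x)\<^sup>2 \<le> k * (2 * c\<^sup>2 * (norm x)\<^sup>2 - 2 * c * (norm (P x))\<^sup>2)" for x
  proof -
    let ?y = "Q (P x) - complex_of_real c *\<^sub>C x"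
    have "norm x \<le> onorm S * norm ?y"
      using onorm[OF blS, of ?y] by (simp add: S(2))
    also have "\<dots> \<le> (onorm S + 1) * norm ?y"
      by (simp add: mult_right_mono)
    finally have lower: "(norm x)\<^sup>2 \<le> k * (norm ?y)\<^sup>2"
      unfolding k_def power_mult_distrib[symmetric] by (rule power_mono) simp
    have cross: "Re \<langle>Q (P x), complex_of_real (- c) *\<^sub>C x\<rangle> = - c * (norm (P x))\<^sup>2"
      by (simp add: cinner_scaleC_right adj' cinner_self)
    have expand: "(norm ?y)\<^sup>2 = (norm (Q (P x)))\<^sup>2 - 2 * c * (norm (P x))\<^sup>2 + c\<^sup>2 * (norm x)\<^sup>2"
      using norm_add_square[of "Q (P x)" "complex_of_real (- c) *\<^sub>C x"]
      unfolding cross norm_scaleC by (simp add: scaleC_minus_left power_mult_distrib)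
    have "norm (Q (P x)) \<le> onorm P * (onorm P * norm x)"
      using normQ[of "P x"] onorm[OF bl, of x] onorm_pos_le[OF bl]
      by (meson mult_left_mono order_trans)
    then have "(norm (Q (P x)))\<^sup>2 \<le> (onorm P * (onorm P * norm x))\<^sup>2"
      by (rule power_mono) simp
    also have "\<dots> = c\<^sup>2 * (norm x)\<^sup>2"
      by (simp add: c_def power_mult_distrib power2_eq_square)
    finally have "(norm ?y)\<^sup>2 \<le> 2 * c\<^sup>2 * (norm x)\<^sup>2 - 2 * c * (norm (P x))\<^sup>2"
      unfolding expand by simp
    then show ?thesis
      using lower k by (meson mult_left_mono order_less_imp_le order_trans)
  qed
  show False
  proof (cases "c = 0")
    case True
    then show False
      using key nontrivial by auto
  next
    case False
    then have c: "c > 0"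
      using c0 by simp
    \<comment> \<open>The bound \<open>key\<close> solved for \<open>\<parallel>P x\<parallel>\<^sup>2\<close>.\<close>
    define d where "d = c - 1 / (2 * k * c)"
    have bound: "(norm (P x))\<^sup>2 \<le> d * (norm x)\<^sup>2" for x
      using key[of x] c k by (simp add: d_def field_simps power2_eq_square)
    have d0: "d \<ge> 0"
    proof -
      obtain x :: 'a where "x \<noteq> 0"
        using nontrivial by blast
      moreover have "0 \<le> d * (norm x)\<^sup>2"
        using bound[of x] zero_le_power2 order_trans by blast
      ultimately show ?thesis
        by (simp add: zero_le_mult_iff)
    qed
    have "onorm P \<le> sqrt d"
    proof (rule onorm_bound)
      show "norm (P x) \<le> sqrt d * norm x" for x
        using real_le_rsqrt[OF bound[of x]] by (simp add: real_sqrt_mult)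
    qed (simp add: d0)
    then have "c \<le> d"
      using power_mono[of "onorm P" "sqrt d" 2] onorm_pos_le[OF bl] d0 by (simp add: c_def)
    then show False
      using c k by (simp add: d_def field_simps)
  qed
qed

section \<open>Polynomials in an operator\<close>

text \<open>
  Horner's scheme, so that inductions over \<^const>\<open>pCons\<close> need no powers of \<open>A\<close>.
\<close>
definition poly_op :: "('a::complex_hilbert \<Rightarrow> 'a) \<Rightarrow> complex poly \<Rightarrow> 'a \<Rightarrow> 'a" where
  "poly_op A p x = fold_coeffs (\<lambda>c v. c *\<^sub>C x + A v) p 0"

lemma poly_op_0 [simp]: "poly_op A 0 x = 0"
  by (simp add: poly_op_def)

context
  fixes A :: "'a::complex_hilbert \<Rightarrow> 'a"
  assumes A: "bounded_clinear A"
begin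

lemma poly_op_pCons [simp]: "poly_op A (pCons c p) x = c *\<^sub>C x + A (poly_op A p x)"
  by (cases "p = 0 \<and> c = 0") (auto simp: poly_op_def bounded_clinear_linear[OF A])

lemma bounded_clinear_poly_op: "bounded_clinear (poly_op A p)"
proof (induction p)
  case 0
  have "poly_op A 0 = (\<lambda>x. 0)"
    by (simp add: fun_eq_iff)
  then show ?case
    by (simp add: bounded_clinear_zero)
next
  case (pCons c p)
  have "poly_op A (pCons c p) = (\<lambda>x. c *\<^sub>C x + A (poly_op A p x))"
    by (simp add: fun_eq_iff)
  then show ?case
    by (simp add: bounded_clinear_add bounded_clinear_scaleC bounded_clinear_compose[OF A] pCons)
qed

lemma poly_op_add: "poly_op A (p + q) x = poly_op A p x + poly_op A q x"
  by (induction p q rule: poly_induct2)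
    (simp_all add: bounded_clinear_linear[OF A] scaleC_add_left)

lemma poly_op_smult: "poly_op A (smult c p) x = c *\<^sub>C poly_op A p x"
  by (induction p) (simp_all add: bounded_clinear_linear[OF A] scaleC_add_right scaleC_scaleC)

lemma poly_op_diff: "poly_op A (p - q) x = poly_op A p x - poly_op A q x"
  using poly_op_add[of p "- q" x] poly_op_smult[of "- 1" q x] by (simp add: scaleC_minus_left)

lemma poly_op_mult: "poly_op A (p * q) x = poly_op A p (poly_op A q x)"
  by (induction p)
    (simp_all add: poly_op_add poly_op_smult bounded_clinear_linear[OF A])

lemma poly_op_commute: "poly_op A p (poly_op A q x) = poly_op A q (poly_op A p x)"
  by (metis poly_op_mult mult.commute)

lemma poly_op_linear_factor: "poly_op A [:- z, 1:] x = A x - z *\<^sub>C x"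
  by (simp add: scaleC_minus_left bounded_clinear_linear[OF A])

lemma poly_op_A_commute: "poly_op A p (A x) = A (poly_op A p x)"
  using poly_op_commute[of p "[:0, 1:]" x] by (simp add: bounded_clinear_linear[OF A])

text \<open>
  If \<open>p(A) - p(z)\<close> were invertible, then so would be its factor \<open>A - z\<close>.
\<close>
lemma poly_in_spectrum_poly_op:
  assumes "z \<in> op_spectrum A"
  shows "poly p z \<in> op_spectrum (poly_op A p)"
proof (rule ccontr)
  obtain s where s: "p - [:poly p z:] = [:- z, 1:] * s"
    using poly_eq_0_iff_dvd[of "p - [:poly p z:]" z] by (auto elim: dvdE)
  have "poly_op A p x - poly p z *\<^sub>C x = poly_op A (p - [:poly p z:]) x" for x
    by (simp add: poly_op_diff bounded_clinear_linear[OF A])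
  then have eq: "poly_op A p x - poly p z *\<^sub>C x = poly_op A s (poly_op A [:- z, 1:] x)" for x
    unfolding s poly_op_mult using poly_op_commute by simp
  assume "poly p z \<notin> op_spectrum (poly_op A p)"
  then have "invertible_op (\<lambda>x. poly_op A s (poly_op A [:- z, 1:] x))"
    by (simp only: op_spectrum_def mem_Collect_eq not_not eq)
  then have "invertible_op (poly_op A [:- z, 1:])"
    by (rule invertible_op_commuting_factor[where S = "poly_op A s" and T = "poly_op A [:- z, 1:]",
          OF bounded_clinear_poly_op poly_op_commute])
  also have "poly_op A [:- z, 1:] = (\<lambda>x. A x - z *\<^sub>C x)"
    by (rule ext) (rule poly_op_linear_factor)
  finally show False
    using assms by (simp add: op_spectrum_def)
qed

lemma cmod_poly_le_onorm: "z \<in> op_spectrum A \<Longrightarrow> cmod (poly p z) \<le> onorm (poly_op A p)"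
  by (rule cmod_le_onorm_if_in_spectrum[OF bounded_clinear_poly_op poly_in_spectrum_poly_op])

text \<open>
  Over \<open>\<complex>\<close> the polynomial splits into linear factors, and a product of invertible operators is
  invertible.  For \<open>r = 0\<close> every point of the spectrum is a root, and there has to be one.
\<close>
lemma noninvertible_poly_op_root:
  assumes "op_spectrum A \<noteq> {}" "\<not> invertible_op (poly_op A r)"
  shows "\<exists>z\<in>op_spectrum A. poly r z = 0"
  using assms(2)
proof (induction "degree r" arbitrary: r rule: less_induct)
  case less
  show ?case
  proof (cases "degree r = 0")
    case True
    then obtain c where r: "r = [:c:]"
      by (rule degree_eq_zeroE)
    have "c = 0"
    proof (rule ccontr)
      assume "c \<noteq> 0"
      then have "invertible_op (\<lambda>x::'a. c *\<^sub>C x)"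
        by (rule invertible_op_scaleC)
      also have "(\<lambda>x. c *\<^sub>C x) = poly_op A r"
        by (simp add: r fun_eq_iff bounded_clinear_linear[OF A])
      finally show False
        using less.prems by blast
    qed
    then show ?thesis
      using assms(1) r by auto
  next
    case nonconst: False
    then obtain a where a: "poly r a = 0"
      using fundamental_theorem_of_algebra[of r] constant_degree[of r] by auto
    then obtain s where s: "r = [:- a, 1:] * s"
      by (auto simp: poly_eq_0_iff_dvd elim: dvdE)
    show ?thesis
    proof (cases "a \<in> op_spectrum A")
      case True
      then show ?thesis
        using a by blast
    next
      case False
      then have inv: "invertible_op (\<lambda>x. A x - a *\<^sub>C x)"
        by (simp add: op_spectrum_def)
      have "r \<noteq> 0"
        using nonconst by auto
      then have "degree s < degree r"
        by (auto simp: s degree_mult_eq simp del: mult_pCons_left)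
      moreover have "\<not> invertible_op (poly_op A s)"
      proof
        assume "invertible_op (poly_op A s)"
        with inv have "invertible_op (\<lambda>x. A (poly_op A s x) - a *\<^sub>C poly_op A s x)"
          by (rule invertible_op_compose)
        also have "(\<lambda>x. A (poly_op A s x) - a *\<^sub>C poly_op A s x) = poly_op A r"
          by (rule ext) (simp only: s poly_op_mult poly_op_linear_factor)
        finally show False
          using less.prems by blast
      qed
      ultimately obtain z where "z \<in> op_spectrum A" "poly s z = 0"
        using less.hyps by blast
      then show ?thesis
        by (auto simp: s)
    qed
  qed
qed

end

locale real_spectrum_op =
  fixes A :: "'a::complex_hilbert \<Rightarrow> 'a"
  assumes selfadjoint: "selfadjoint A"
    and real_spectrum: "op_spectrum A \<subseteq> \<real>"
begin

lemma bounded_clinear: "bounded_clinear A"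
  using selfadjoint by (simp add: selfadjoint_def)

lemmas poly_op_simps = poly_op_pCons[OF bounded_clinear] bounded_clinear_linear[OF bounded_clinear]

lemma cinner_poly_op: "\<langle>poly_op A p x, y\<rangle> = \<langle>x, poly_op A (map_poly cnj p) y\<rangle>"
proof (induction p arbitrary: y)
  case (pCons c p)
  have adj: "\<langle>A u, v\<rangle> = \<langle>u, A v\<rangle>" for u v
    using selfadjoint unfolding selfadjoint_def adjoint_pair_def by blast
  show ?case
    by (simp add: poly_op_simps adj map_poly_pCons cinner_add_left cinner_add_right
        cinner_scaleC_left cinner_scaleC_right pCons.IH poly_op_A_commute[OF bounded_clinear])
qed simp

text \<open>
  The point \<open>\<parallel>A\<parallel>\<^sup>2\<close> of the spectrum of \<open>A\<^sup>2\<close> makes one factor of \<open>(A - \<parallel>A\<parallel>) (A + \<parallel>A\<parallel>)\<close>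
  noninvertible.
\<close>
lemma spectrum_nonempty:
  assumes nontrivial: "\<exists>x::'a. x \<noteq> 0"
  shows "op_spectrum A \<noteq> {}"
proof
  assume empty: "op_spectrum A = {}"
  have factor: "invertible_op (\<lambda>x. A x - c *\<^sub>C x)" for c
    using empty by (auto simp: op_spectrum_def)
  define a where "a = complex_of_real (onorm A)"
  have "complex_of_real ((onorm A)\<^sup>2) \<in> op_spectrum (\<lambda>x. A (A x))"
    using selfadjoint nontrivial
    by (intro onorm_square_in_spectrum) (auto simp: selfadjoint_def)
  then have "\<not> invertible_op (\<lambda>x. A (A x) - (a * a) *\<^sub>C x)"
    by (simp add: op_spectrum_def a_def power2_eq_square)
  moreover have "invertible_op (\<lambda>x. A (A x - a *\<^sub>C x) - (- a) *\<^sub>C (A x - a *\<^sub>C x))"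
    by (rule invertible_op_compose[OF factor factor])
  moreover have "A (A x - a *\<^sub>C x) - (- a) *\<^sub>C (A x - a *\<^sub>C x) = A (A x) - (a * a) *\<^sub>C x" for x
    by (simp add: bounded_clinear_linear(2,3)[OF bounded_clinear] scaleC_minus_left
        scaleC_diff_right scaleC_scaleC)
  ultimately show False
    by simp
qed

text \<open>
  The number \<open>\<parallel>p(A)\<parallel>\<^sup>2\<close> belongs to the spectrum of \<open>p(A)\<^sup>* p(A) = q(A)\<close>, where \<open>q\<close> is the product
  of \<open>p\<close> and its conjugate.  Hence \<open>q - \<parallel>p(A)\<parallel>\<^sup>2\<close> vanishes somewhere on the spectrum of \<open>A\<close>; and
  there \<open>q = \<bar>p\<bar>\<^sup>2\<close>, because the spectrum is real.
\<close>
lemma norm_poly_op_le: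
  assumes bound: "\<And>z. z \<in> op_spectrum A \<Longrightarrow> cmod (poly p z) \<le> M" and "0 \<le> M"
  shows "norm (poly_op A p x) \<le> M * norm x"
proof (cases "\<exists>x::'a. x \<noteq> 0")
  case False
  then have "poly_op A p x = 0"
    by blast
  then show ?thesis
    using \<open>0 \<le> M\<close> by simp
next
  case True
  define P Q where "P = poly_op A p" and "Q = poly_op A (map_poly cnj p)"
  define c where "c = complex_of_real ((onorm P)\<^sup>2)"
  define r where "r = map_poly cnj p * p - [:c:]"
  have bcl: "bounded_clinear P" "bounded_clinear Q"
    unfolding P_def Q_def by (rule bounded_clinear_poly_op[OF bounded_clinear])+
  have "\<langle>Q x, y\<rangle> = \<langle>x, P y\<rangle>" for x y
    unfolding P_def Q_def by (metis cinner_poly_op cinner_commute)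
  then have "c \<in> op_spectrum (\<lambda>x. Q (P x))"
    unfolding c_def using bcl True by (intro onorm_square_in_spectrum) (auto simp: adjoint_pair_def)
  moreover have "(\<lambda>x. Q (P x) - c *\<^sub>C x) = poly_op A r"
    by (simp add: r_def P_def Q_def fun_eq_iff poly_op_diff[OF bounded_clinear]
        poly_op_mult[OF bounded_clinear] poly_op_simps)
  ultimately have "\<not> invertible_op (poly_op A r)"
    by (simp add: op_spectrum_def)
  then obtain z where z: "z \<in> op_spectrum A" "poly r z = 0"
    using noninvertible_poly_op_root[OF bounded_clinear spectrum_nonempty[OF True]] by blast
  have "cnj z = z"
    using z(1) real_spectrum by (auto simp: Reals_cnj_iff)
  then have "poly (map_poly cnj p) z = cnj (poly p z)"
    using poly_cnj[of p z] by simp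
  then have "complex_of_real ((onorm P)\<^sup>2) = complex_of_real ((cmod (poly p z))\<^sup>2)"
    unfolding complex_norm_square using z(2) by (simp add: r_def c_def mult.commute)
  then have "(onorm P)\<^sup>2 = (cmod (poly p z))\<^sup>2"
    unfolding of_real_eq_iff .
  then have le: "onorm P \<le> M"
    using bound[OF z(1)] by (simp add: power2_eq_iff_nonneg onorm_pos_le
        bounded_clinear_imp_bounded_linear[OF bcl(1)])
  have "norm (poly_op A p x) \<le> onorm P * norm x"
    unfolding P_def
    by (rule onorm[OF bounded_clinear_imp_bounded_linear[OF bounded_clinear_poly_op[OF bounded_clinear]]])
  also have "\<dots> \<le> M * norm x"
    using le by (rule mult_right_mono) simp
  finally show ?thesis .
qed

end

section \<open>The continuous functional calculus\<close>

lemma small_multiple: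
  fixes e b :: real
  assumes "0 < e" "0 \<le> b"
  shows "\<exists>d>0. d * b < e"
  using assms by (intro exI[of _ "e / (b + 1)"]) (simp add: field_simps)

text \<open>
  On a real set a complex function splits into its real and imaginary parts as functions of one
  real variable, to which the Weierstrass theorem applies.
\<close>
lemma complex_poly_approximation_on_reals:
  assumes K: "compact K" "K \<subseteq> \<real>" and f: "continuous_on K f" and "0 < e"
  shows "\<exists>p. \<forall>z\<in>K. cmod (poly p z - f z) < e"
proof -
  define S where "S = Re ` K"
  have S: "compact S"
    unfolding S_def by (intro compact_continuous_image continuous_intros K)
  have K_eq: "complex_of_real t \<in> K" if "t \<in> S" for t
    using that K(2) by (auto simp: S_def of_real_Re subset_iff)
  have cont: "continuous_on S (\<lambda>t. f (complex_of_real t))"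
    by (rule continuous_on_compose2[OF f]) (auto intro!: continuous_intros K_eq)
  have real_approx: "\<exists>p. \<forall>t\<in>S. cmod (complex_of_real (u t) - poly p (complex_of_real t)) < e / 2"
    if "continuous_on S u" for u :: "real \<Rightarrow> real"
  proof -
    obtain v where v: "real_polynomial_function v" "\<And>t. t \<in> S \<Longrightarrow> \<bar>u t - v t\<bar> < e / 2"
      using Stone_Weierstrass_real_polynomial_function[OF S \<open>continuous_on S u\<close>, of "e / 2"]
        \<open>0 < e\<close> by auto
    obtain a n where a: "v = (\<lambda>t. \<Sum>i\<le>n. a i * t ^ i)"
      using v(1) unfolding real_polynomial_function_iff_sum by blast
    define p where "p = (\<Sum>i\<le>n. monom (complex_of_real (a i)) i)"
    have "poly p (complex_of_real t) = complex_of_real (v t)" for t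
      by (simp add: p_def a poly_sum poly_monom)
    then have "cmod (complex_of_real (u t) - poly p (complex_of_real t)) = \<bar>u t - v t\<bar>" for t
      by (simp flip: of_real_diff)
    then show ?thesis
      using v(2) by (intro exI[of _ p]) simp
  qed
  obtain p where p: "\<forall>t\<in>S. cmod (complex_of_real (Re (f (complex_of_real t)))
      - poly p (complex_of_real t)) < e / 2"
    using real_approx[OF continuous_on_Re[OF cont]] by blast
  obtain q where q: "\<forall>t\<in>S. cmod (complex_of_real (Im (f (complex_of_real t)))
      - poly q (complex_of_real t)) < e / 2"
    using real_approx[OF continuous_on_Im[OF cont]] by blast
  have "cmod (poly (p + smult \<i> q) z - f z) < e" if "z \<in> K" for z
  proof -
    define t where "t = Re z"
    have z: "z = complex_of_real t" and t: "t \<in> S"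
      using that K(2) by (auto simp: t_def S_def of_real_Re subset_iff)
    define a b where "a = complex_of_real (Re (f z))" and "b = complex_of_real (Im (f z))"
    have f_eq: "f z = a + \<i> * b"
      unfolding a_def b_def by (rule complex_eq)
    have "poly (p + smult \<i> q) z - f z = - ((a - poly p z) + \<i> * (b - poly q z))"
      unfolding poly_add poly_smult by (subst f_eq) (simp add: algebra_simps)
    then have "cmod (poly (p + smult \<i> q) z - f z) \<le> cmod (a - poly p z) + cmod (b - poly q z)"
      using norm_triangle_ineq[of "a - poly p z" "\<i> * (b - poly q z)"]
      by (simp only: norm_minus_cancel norm_mult norm_ii mult_1_left)
    also have "\<dots> < e"
      using bspec[OF p t] bspec[OF q t] unfolding a_def b_def z by simp
    finally show ?thesis .
  qed
  then show ?thesis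
    by blast
qed

definition poly_approx :: "complex set \<Rightarrow> (complex \<Rightarrow> complex) \<Rightarrow> nat \<Rightarrow> complex poly" where
  "poly_approx K f n = (SOME p. \<forall>z\<in>K. cmod (poly p z - f z) < inverse (real (Suc n)))"

lemma uniform_limit_poly_approx:
  assumes "compact K" "K \<subseteq> \<real>" "continuous_on K f"
  shows "uniform_limit K (\<lambda>n. poly (poly_approx K f n)) f sequentially"
proof (rule uniform_limitI)
  fix e :: real
  assume "0 < e"
  have approx: "\<forall>z\<in>K. cmod (poly (poly_approx K f n) z - f z) < inverse (real (Suc n))" for n
    unfolding poly_approx_def
    by (rule someI_ex, rule complex_poly_approximation_on_reals) (use assms in simp_all)
  obtain N where N: "inverse (real (Suc N)) < e"
    using reals_Archimedean[OF \<open>0 < e\<close>] by blast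
  have "dist (poly (poly_approx K f n) z) (f z) < e" if "N \<le> n" "z \<in> K" for n z
  proof -
    have "inverse (real (Suc n)) \<le> inverse (real (Suc N))"
      using that(1) by (intro le_imp_inverse_le) auto
    moreover have "dist (poly (poly_approx K f n) z) (f z) < inverse (real (Suc n))"
      using approx[of n] that(2) by (simp add: dist_norm)
    ultimately show ?thesis
      using N by linarith
  qed
  then show "\<forall>\<^sub>F n in sequentially. \<forall>z\<in>K. dist (poly (poly_approx K f n) z) (f z) < e"
    by (auto simp: eventually_sequentially)
qed

text \<open>
  The approximating polynomials are fixed once and for all; that every other uniformly convergent
  sequence of polynomials leads to the same limit is shown below.
\<close>
definition limit_calculus ::
    "('a::complex_hilbert \<Rightarrow> 'a) \<Rightarrow> (complex \<Rightarrow> complex) \<Rightarrow> 'a \<Rightarrow> 'a" where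
  "limit_calculus A f x = lim (\<lambda>n. poly_op A (poly_approx (op_spectrum A) f n) x)"

lemma limit_calculus_cong:
  assumes "\<And>z. z \<in> op_spectrum A \<Longrightarrow> f z = g z"
  shows "limit_calculus A f = limit_calculus A g"
proof -
  have "poly_approx (op_spectrum A) f = poly_approx (op_spectrum A) g"
    using assms by (simp add: poly_approx_def fun_eq_iff)
  then show ?thesis
    by (simp add: limit_calculus_def fun_eq_iff)
qed

context real_spectrum_op
begin

abbreviation "C \<equiv> {f::complex \<Rightarrow> complex. continuous_on (op_spectrum A) f}"

abbreviation "poly_limit p f \<equiv> uniform_limit (op_spectrum A) (\<lambda>n. poly (p n)) f sequentially"

lemma compact_spectrum: "compact (op_spectrum A)"
  by (rule compact_op_spectrum[OF bounded_clinear])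

lemma poly_limit_poly_approx: "f \<in> C \<Longrightarrow> poly_limit (poly_approx (op_spectrum A) f) f"
  using uniform_limit_poly_approx[OF compact_spectrum real_spectrum] by simp

lemma bounded_image: "f \<in> C \<Longrightarrow> bounded (f ` op_spectrum A)"
  using compact_continuous_image compact_imp_bounded compact_spectrum by blast

lemma poly_op_Cauchy:
  assumes "poly_limit p f"
  shows "Cauchy (\<lambda>n. poly_op A (p n) x)"
proof (rule metric_CauchyI)
  fix e :: real
  assume "0 < e"
  obtain d where d: "d > 0" "d * norm x < e"
    using small_multiple[OF \<open>0 < e\<close> norm_ge_zero] by blast
  obtain N where N: "\<And>n z. N \<le> n \<Longrightarrow> z \<in> op_spectrum A \<Longrightarrow> cmod (poly (p n) z - f z) < d / 2"
    using uniform_limitD[OF assms, of "d / 2"] d(1)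
    by (auto simp: eventually_sequentially dist_norm)
  have "dist (poly_op A (p m) x) (poly_op A (p n) x) < e" if "N \<le> m" "N \<le> n" for m n
  proof -
    have "norm (poly_op A (p m - p n) x) \<le> d * norm x"
    proof (rule norm_poly_op_le)
      fix z
      assume "z \<in> op_spectrum A"
      then show "cmod (poly (p m - p n) z) \<le> d"
        using N[OF that(1), of z] N[OF that(2), of z]
          norm_triangle_ineq4[of "poly (p m) z - f z" "poly (p n) z - f z"] by simp
    qed (use d in simp)
    then show ?thesis
      using d by (simp add: dist_norm poly_op_diff[OF bounded_clinear])
  qed
  then show "\<exists>M. \<forall>m\<ge>M. \<forall>n\<ge>M. dist (poly_op A (p m) x) (poly_op A (p n) x) < e"
    by blast
qed

text \<open>
  Interleaving a given approximating sequence with the fixed one gives a third one, which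
  is Cauchy as well, so the two limits agree.
\<close>
lemma limit_calculus_tendsto:
  assumes p: "poly_limit p f" and f: "f \<in> C"
  shows "(\<lambda>n. poly_op A (p n) x) \<longlonglongrightarrow> limit_calculus A f x"
proof -
  define q where "q = poly_approx (op_spectrum A) f"
  have q: "poly_limit q f"
    unfolding q_def by (rule poly_limit_poly_approx[OF f])
  have q_lim: "(\<lambda>n. poly_op A (q n) x) \<longlonglongrightarrow> limit_calculus A f x"
    using poly_op_Cauchy[OF q, of x] unfolding limit_calculus_def q_def
    by (simp add: Cauchy_convergent_iff convergent_LIMSEQ_iff)
  define r where "r n = (if even n then p (n div 2) else q (n div 2))" for n
  have "poly_limit r f"
  proof (rule uniform_limitI)
    fix e :: real
    assume "0 < e"
    obtain N where N: "\<And>n z. N \<le> n \<Longrightarrow> z \<in> op_spectrum A \<Longrightarrow> dist (poly (p n) z) (f z) < e"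
      using uniform_limitD[OF p \<open>0 < e\<close>] by (auto simp: eventually_sequentially)
    obtain M where M: "\<And>n z. M \<le> n \<Longrightarrow> z \<in> op_spectrum A \<Longrightarrow> dist (poly (q n) z) (f z) < e"
      using uniform_limitD[OF q \<open>0 < e\<close>] by (auto simp: eventually_sequentially)
    have "dist (poly (r n) z) (f z) < e" if "2 * (N + M) \<le> n" "z \<in> op_spectrum A" for n z
      using that N[of "n div 2" z] M[of "n div 2" z] by (auto simp: r_def)
    then show "\<forall>\<^sub>F n in sequentially. \<forall>z\<in>op_spectrum A. dist (poly (r n) z) (f z) < e"
      by (auto simp: eventually_sequentially)
  qed
  then obtain y where y: "(\<lambda>n. poly_op A (r n) x) \<longlonglongrightarrow> y"
    using poly_op_Cauchy[of r f x] by (auto simp: Cauchy_convergent_iff convergent_def)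
  have "(\<lambda>n. poly_op A (q n) x) \<longlonglongrightarrow> y"
    using LIMSEQ_subseq_LIMSEQ[OF y, of "\<lambda>n. 2 * n + 1"] by (simp add: strict_mono_def o_def r_def)
  then have "y = limit_calculus A f x"
    using q_lim LIMSEQ_unique by blast
  then show ?thesis
    using LIMSEQ_subseq_LIMSEQ[OF y, of "\<lambda>n. 2 * n"] by (simp add: strict_mono_def o_def r_def)
qed

lemma limit_calculus_poly: "limit_calculus A (poly p) x = poly_op A p x"
  using limit_calculus_tendsto[of "\<lambda>_. p" "poly p" x]
  by (simp add: uniform_limit_const continuous_on_poly LIMSEQ_const_iff)

lemma limit_calculus_const: "limit_calculus A (\<lambda>z. c) = (\<lambda>x. c *\<^sub>C x)"
proof -
  have "(\<lambda>z. c) = poly [:c:]"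
    by (simp add: fun_eq_iff)
  then have "limit_calculus A (\<lambda>z. c) = limit_calculus A (poly [:c:])"
    by (rule arg_cong)
  then show ?thesis
    by (simp add: fun_eq_iff limit_calculus_poly poly_op_simps)
qed

lemma limit_calculus_ident: "limit_calculus A (\<lambda>z. z) = A"
proof -
  have "(\<lambda>z::complex. z) = poly [:0, 1:]"
    by (simp add: fun_eq_iff)
  then have "limit_calculus A (\<lambda>z. z) = limit_calculus A (poly [:0, 1:])"
    by (rule arg_cong)
  then show ?thesis
    by (simp add: fun_eq_iff limit_calculus_poly poly_op_simps)
qed

lemma norm_limit_calculus_le:
  assumes f: "f \<in> C" and bound: "\<And>z. z \<in> op_spectrum A \<Longrightarrow> cmod (f z) \<le> M" and "0 \<le> M"
  shows "norm (limit_calculus A f x) \<le> M * norm x"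
proof (rule field_le_epsilon)
  fix e :: real
  assume "0 < e"
  obtain d where d: "d > 0" "d * norm x < e"
    using small_multiple[OF \<open>0 < e\<close> norm_ge_zero] by blast
  let ?p = "poly_approx (op_spectrum A) f"
  have "\<forall>\<^sub>F n in sequentially. norm (poly_op A (?p n) x) \<le> (M + d) * norm x"
    using uniform_limitD[OF poly_limit_poly_approx[OF f] d(1)]
  proof eventually_elim
    case (elim n)
    show ?case
    proof (rule norm_poly_op_le)
      fix z
      assume z: "z \<in> op_spectrum A"
      then show "cmod (poly (?p n) z) \<le> M + d"
        using elim[rule_format, OF z] bound[OF z] norm_triangle_sub[of "poly (?p n) z" "f z"]
        by (simp add: dist_norm)
    qed (use d \<open>0 \<le> M\<close> in simp)
  qed
  then have "norm (limit_calculus A f x) \<le> (M + d) * norm x"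
    by (rule tendsto_upperbound[OF tendsto_norm[OF limit_calculus_tendsto[OF poly_limit_poly_approx[OF f] f]]])
      simp
  then show "norm (limit_calculus A f x) \<le> M * norm x + e"
    using d by (simp add: distrib_right)
qed

lemma limit_calculus_lincomb:
  assumes f: "f \<in> C" and g: "g \<in> C"
  shows "limit_calculus A (\<lambda>z. a * f z + b * g z) x
      = a *\<^sub>C limit_calculus A f x + b *\<^sub>C limit_calculus A g x"
proof (rule LIMSEQ_unique)
  let ?p = "poly_approx (op_spectrum A) f" and ?q = "poly_approx (op_spectrum A) g"
  have "poly_limit (\<lambda>n. smult a (?p n) + smult b (?q n)) (\<lambda>z. a * f z + b * g z)"
    using f g unfolding poly_add poly_smult
    by (intro uniform_limit_intros poly_limit_poly_approx)
  then show "(\<lambda>n. poly_op A (smult a (?p n) + smult b (?q n)) x)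
      \<longlonglongrightarrow> limit_calculus A (\<lambda>z. a * f z + b * g z) x"
    by (rule limit_calculus_tendsto) (use f g in \<open>auto intro!: continuous_intros\<close>)
  have scale: "((\<lambda>n. c *\<^sub>C u n) \<longlongrightarrow> c *\<^sub>C l) sequentially" if "u \<longlonglongrightarrow> l"
    for c and u :: "nat \<Rightarrow> 'a" and l
    by (rule bounded_linear.tendsto[OF bounded_clinear_imp_bounded_linear that])
      (rule bounded_clinear_scaleC)
  show "(\<lambda>n. poly_op A (smult a (?p n) + smult b (?q n)) x)
      \<longlonglongrightarrow> a *\<^sub>C limit_calculus A f x + b *\<^sub>C limit_calculus A g x"
    unfolding poly_op_add[OF bounded_clinear] poly_op_smult[OF bounded_clinear]
    by (intro tendsto_add scale limit_calculus_tendsto poly_limit_poly_approx f g)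
qed

lemma bounded_clinear_limit_calculus:
  assumes f: "f \<in> C"
  shows "bounded_clinear (limit_calculus A f)"
proof -
  let ?p = "poly_approx (op_spectrum A) f"
  note lim = limit_calculus_tendsto[OF poly_limit_poly_approx[OF f] f]
  note poly_lin = bounded_clinear_linear[OF bounded_clinear_poly_op[OF bounded_clinear]]
  obtain M where M: "M > 0" "\<And>z. z \<in> op_spectrum A \<Longrightarrow> cmod (f z) \<le> M"
    using bounded_image[OF f] unfolding bounded_pos by auto
  show ?thesis
  proof (rule bounded_clinearI)
    show "limit_calculus A f (x + y) = limit_calculus A f x + limit_calculus A f y" for x y
      using lim[of "x + y"] tendsto_add[OF lim[of x] lim[of y]]
      unfolding poly_lin by (rule LIMSEQ_unique)
    show "limit_calculus A f (c *\<^sub>C x) = c *\<^sub>C limit_calculus A f x" for c x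
      using lim[of "c *\<^sub>C x"]
        bounded_linear.tendsto[OF bounded_clinear_imp_bounded_linear[OF bounded_clinear_scaleC] lim]
      unfolding poly_lin by (rule LIMSEQ_unique)
    show "norm (limit_calculus A f x) \<le> norm x * M" for x
      using norm_limit_calculus_le[OF f M(2), of x] M(1) by (simp add: mult.commute)
  qed
qed

text \<open>
  In \<open>p\<^sub>n(A) (q\<^sub>n(A) x)\<close> both the operator and the vector vary; the operators \<open>p\<^sub>n(A)\<close> are bounded in
  norm by a common constant, because the \<open>p\<^sub>n\<close> are so on the spectrum.
\<close>
lemma limit_calculus_mult:
  assumes f: "f \<in> C" and g: "g \<in> C"
  shows "limit_calculus A (\<lambda>z. f z * g z) x = limit_calculus A f (limit_calculus A g x)"
proof (rule LIMSEQ_unique)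
  let ?p = "poly_approx (op_spectrum A) f" and ?q = "poly_approx (op_spectrum A) g"
  note p = poly_limit_poly_approx[OF f] and q = poly_limit_poly_approx[OF g]
  have "poly_limit (\<lambda>n. ?p n * ?q n) (\<lambda>z. f z * g z)"
    unfolding poly_mult by (intro uniform_lim_mult p q bounded_image f g)
  then show "(\<lambda>n. poly_op A (?p n * ?q n) x) \<longlonglongrightarrow> limit_calculus A (\<lambda>z. f z * g z) x"
    by (rule limit_calculus_tendsto) (use f g in \<open>auto intro!: continuous_intros\<close>)
  obtain M where M: "M > 0" "\<And>z. z \<in> op_spectrum A \<Longrightarrow> cmod (f z) \<le> M"
    using bounded_image[OF f] unfolding bounded_pos by auto
  let ?y = "limit_calculus A g x"
  have "(\<lambda>n. poly_op A (?q n) x - ?y) \<longlonglongrightarrow> 0"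
    using limit_calculus_tendsto[OF q g] by (simp add: LIM_zero)
  then have small: "(\<lambda>n. (M + 1) * norm (poly_op A (?q n) x - ?y)) \<longlonglongrightarrow> 0"
    by (intro tendsto_mult_right_zero tendsto_norm_zero)
  have "\<forall>\<^sub>F n in sequentially. norm (poly_op A (?p n) (poly_op A (?q n) x - ?y))
      \<le> (M + 1) * norm (poly_op A (?q n) x - ?y)"
    using uniform_limitD[OF p zero_less_one]
  proof eventually_elim
    case (elim n)
    show ?case
    proof (rule norm_poly_op_le)
      fix z
      assume z: "z \<in> op_spectrum A"
      then show "cmod (poly (?p n) z) \<le> M + 1"
        using elim[rule_format, OF z] M(2)[OF z] norm_triangle_sub[of "poly (?p n) z" "f z"]
        by (simp add: dist_norm)
    qed (use M in simp)
  qed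
  then have "(\<lambda>n. poly_op A (?p n) (poly_op A (?q n) x - ?y)) \<longlonglongrightarrow> 0"
    by (rule Lim_null_comparison[OF _ small])
  then have "(\<lambda>n. poly_op A (?p n) (poly_op A (?q n) x - ?y) + poly_op A (?p n) ?y)
      \<longlonglongrightarrow> 0 + limit_calculus A f ?y"
    by (intro tendsto_add limit_calculus_tendsto p f)
  then show "(\<lambda>n. poly_op A (?p n * ?q n) x) \<longlonglongrightarrow> limit_calculus A f ?y"
    by (simp add: poly_op_mult[OF bounded_clinear]
        bounded_clinear_linear(2)[OF bounded_clinear_poly_op[OF bounded_clinear]])
qed

lemma limit_calculus_cnj:
  assumes f: "f \<in> C"
  shows "adjoint_pair (limit_calculus A f) (limit_calculus A (\<lambda>z. cnj (f z)))"
  unfolding adjoint_pair_def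
proof (intro allI)
  fix x y
  let ?p = "poly_approx (op_spectrum A) f"
  note p = poly_limit_poly_approx[OF f]
  note cinner_lim = bounded_bilinear.tendsto[OF bounded_bilinear_cinner]
  have "uniform_limit (op_spectrum A) (\<lambda>n z. cnj (poly (?p n) z)) (\<lambda>z. cnj (f z)) sequentially"
    by (rule bounded_linear.uniform_limit[OF bounded_linear_cnj p])
  moreover have "cnj (poly q z) = poly (map_poly cnj q) z" if "z \<in> op_spectrum A" for q z
    using that real_spectrum poly_cnj[of q z] by (auto simp: Reals_cnj_iff)
  ultimately have "poly_limit (\<lambda>n. map_poly cnj (?p n)) (\<lambda>z. cnj (f z))"
    by (simp cong: uniform_limit_cong')
  then have "(\<lambda>n. \<langle>x, poly_op A (map_poly cnj (?p n)) y\<rangle>)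
      \<longlonglongrightarrow> \<langle>x, limit_calculus A (\<lambda>z. cnj (f z)) y\<rangle>"
    by (intro cinner_lim tendsto_const limit_calculus_tendsto)
      (use f in \<open>auto intro!: continuous_intros\<close>)
  moreover have "(\<lambda>n. \<langle>poly_op A (?p n) x, y\<rangle>) \<longlonglongrightarrow> \<langle>limit_calculus A f x, y\<rangle>"
    by (intro cinner_lim tendsto_const limit_calculus_tendsto p f)
  ultimately show "\<langle>limit_calculus A f x, y\<rangle> = \<langle>x, limit_calculus A (\<lambda>z. cnj (f z)) y\<rangle>"
    unfolding cinner_poly_op by (metis LIMSEQ_unique)
qed

lemma onorm_limit_calculus:
  assumes f: "f \<in> C"
  shows "onorm (limit_calculus A f) = Sup (insert 0 ((\<lambda>z. cmod (f z)) ` op_spectrum A))"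
    (is "_ = Sup ?B")
proof (rule antisym)
  have bl: "bounded_linear (limit_calculus A f)"
    by (rule bounded_clinear_imp_bounded_linear[OF bounded_clinear_limit_calculus[OF f]])
  obtain M where "M > 0" "\<And>z. z \<in> op_spectrum A \<Longrightarrow> cmod (f z) \<le> M"
    using bounded_image[OF f] unfolding bounded_pos by auto
  then have bdd: "bdd_above ?B"
    by (auto intro!: bdd_aboveI[of _ M])
  show "onorm (limit_calculus A f) \<le> Sup ?B"
  proof (rule onorm_bound)
    show "0 \<le> Sup ?B"
      by (rule cSup_upper[OF _ bdd]) simp
    show "norm (limit_calculus A f x) \<le> Sup ?B * norm x" for x
    proof (rule norm_limit_calculus_le[OF f _ \<open>0 \<le> Sup ?B\<close>])
      show "cmod (f z) \<le> Sup ?B" if "z \<in> op_spectrum A" for z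
        using that by (intro cSup_upper[OF _ bdd]) blast
    qed
  qed
  show "Sup ?B \<le> onorm (limit_calculus A f)"
  proof (rule cSup_least)
    fix b
    assume "b \<in> ?B"
    then consider "b = 0" | z where "z \<in> op_spectrum A" "b = cmod (f z)"
      by auto
    then show "b \<le> onorm (limit_calculus A f)"
    proof cases
      case 1
      then show ?thesis
        using onorm_pos_le[OF bl] by simp
    next
      case 2
      show ?thesis
      proof (rule field_le_epsilon)
        fix e :: real
        assume "0 < e"
        obtain p where p: "\<forall>z\<in>op_spectrum A. cmod (poly p z - f z) < e / 2"
          using complex_poly_approximation_on_reals[OF compact_spectrum real_spectrum, of f "e / 2"]
            f \<open>0 < e\<close> by auto
        have polyC: "poly p \<in> C"
          by (simp add: continuous_on_poly)
        have "onorm (poly_op A p) \<le> onorm (limit_calculus A f) + e / 2"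
        proof (rule onorm_bound)
          fix x
          have "norm (limit_calculus A (\<lambda>z. 1 * poly p z + (- 1) * f z) x) \<le> e / 2 * norm x"
            using p f polyC \<open>0 < e\<close>
            by (intro norm_limit_calculus_le) (auto intro!: continuous_intros less_imp_le)
          then have "norm (poly_op A p x - limit_calculus A f x) \<le> e / 2 * norm x"
            unfolding limit_calculus_lincomb[OF polyC f] limit_calculus_poly
            by (simp add: scaleC_minus_left)
          then show "norm (poly_op A p x) \<le> (onorm (limit_calculus A f) + e / 2) * norm x"
            using onorm[OF bl, of x] norm_triangle_sub[of "poly_op A p x" "limit_calculus A f x"]
            by (simp add: distrib_right)
        qed (use onorm_pos_le[OF bl] \<open>0 < e\<close> in simp)
        then have "cmod (poly p z) \<le> onorm (limit_calculus A f) + e / 2"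
          using cmod_poly_le_onorm[OF bounded_clinear 2(1), of p] by simp
        then show "b \<le> onorm (limit_calculus A f) + e"
          using p 2 norm_triangle_sub[of "f z" "poly p z"] by (force simp: norm_minus_commute)
      qed
    qed
  qed simp
qed

lemma is_cont_calculus_limit_calculus: "is_cont_calculus A (limit_calculus A)"
  unfolding is_cont_calculus_def Let_def
  using bounded_clinear_limit_calculus limit_calculus_lincomb limit_calculus_mult
    limit_calculus_cnj onorm_limit_calculus limit_calculus_const[of 1] limit_calculus_ident
  by (simp add: fun_eq_iff)

text \<open>
  Any calculus is determined on polynomials by its algebraic properties, and then on continuous
  functions by its norm identity.
\<close>
lemma cont_calculus_unique:
  assumes "is_cont_calculus A \<Phi>" and f: "f \<in> C"
  shows "\<Phi> f = limit_calculus A f"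
proof -
  have bcl: "bounded_clinear (\<Phi> u)" if "u \<in> C" for u
    using assms(1) that by (simp add: is_cont_calculus_def Let_def)
  have lincomb: "\<Phi> (\<lambda>z. a * u z + b * v z) = (\<lambda>x. a *\<^sub>C \<Phi> u x + b *\<^sub>C \<Phi> v x)"
    if "u \<in> C" "v \<in> C" for u v a b
    using assms(1) that by (simp add: is_cont_calculus_def Let_def)
  have mult: "\<Phi> (\<lambda>z. u z * v z) = \<Phi> u \<circ> \<Phi> v" if "u \<in> C" "v \<in> C" for u v
    using assms(1) that by (simp add: is_cont_calculus_def Let_def)
  have norm: "onorm (\<Phi> u) = Sup (insert 0 ((\<lambda>z. cmod (u z)) ` op_spectrum A))" if "u \<in> C" for u
    using assms(1) that by (simp add: is_cont_calculus_def Let_def)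
  have one: "\<Phi> (\<lambda>z. 1) = id" and ident: "\<Phi> (\<lambda>z. z) = A"
    using assms(1) by (simp_all add: is_cont_calculus_def Let_def)
  have polyC: "poly p \<in> C" for p
    by (simp add: continuous_on_poly)
  have oneC: "(\<lambda>z. 1) \<in> C" and identC: "(\<lambda>z. z) \<in> C"
    by (simp_all add: continuous_on_id)
  have poly: "\<Phi> (poly p) x = poly_op A p x" for p x
  proof (induction p arbitrary: x)
    case 0
    show ?case
      using lincomb[OF oneC oneC, of 0 0] by (simp add: fun_eq_iff)
  next
    case (pCons c p)
    have "(\<lambda>z. z * poly p z) \<in> C"
      by (auto intro!: continuous_intros)
    \<comment> \<open>The factors \<open>1\<close> put Horner's step into the shape of a linear combination.\<close>
    then have "\<Phi> (\<lambda>z. c * 1 + 1 * (z * poly p z)) x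
        = c *\<^sub>C \<Phi> (\<lambda>z. 1) x + 1 *\<^sub>C \<Phi> (\<lambda>z. z * poly p z) x"
      by (simp only: lincomb[OF oneC])
    also have "\<dots> = c *\<^sub>C x + A (poly_op A p x)"
      by (simp only: mult[OF identC polyC] one ident o_apply pCons.IH id_apply scaleC_1_left)
    finally have "\<Phi> (\<lambda>z. c * 1 + 1 * (z * poly p z)) x = c *\<^sub>C x + A (poly_op A p x)" .
    moreover have "poly (pCons c p) = (\<lambda>z. c * 1 + 1 * (z * poly p z))"
      by auto
    ultimately show ?case
      by (simp add: poly_op_simps)
  qed
  let ?p = "poly_approx (op_spectrum A) f"
  have "\<Phi> f x = limit_calculus A f x" for x
  proof (rule LIMSEQ_unique)
    show "(\<lambda>n. poly_op A (?p n) x) \<longlonglongrightarrow> limit_calculus A f x"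
      by (rule limit_calculus_tendsto[OF poly_limit_poly_approx[OF f] f])
    show "(\<lambda>n. poly_op A (?p n) x) \<longlonglongrightarrow> \<Phi> f x"
    proof (rule metric_LIMSEQ_I)
      fix e :: real
      assume "0 < e"
      obtain d where d: "d > 0" "d * norm x < e"
        using small_multiple[OF \<open>0 < e\<close> norm_ge_zero] by blast
      obtain N where N: "\<And>n z. N \<le> n \<Longrightarrow> z \<in> op_spectrum A \<Longrightarrow> cmod (poly (?p n) z - f z) < d"
        using uniform_limitD[OF poly_limit_poly_approx[OF f] d(1)]
        by (auto simp: eventually_sequentially dist_norm)
      have "dist (poly_op A (?p n) x) (\<Phi> f x) < e" if "N \<le> n" for n
      proof -
        let ?u = "\<lambda>z. 1 * poly (?p n) z + (- 1) * f z"
        have uC: "?u \<in> C"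
          using f by (auto intro!: continuous_intros)
        have "onorm (\<Phi> ?u) \<le> d"
          unfolding norm[OF uC]
          by (rule cSup_least) (use N[OF that] d(1) in \<open>auto intro: less_imp_le\<close>)
        then have "norm (\<Phi> ?u x) \<le> d * norm x"
          using onorm[OF bounded_clinear_imp_bounded_linear[OF bcl[OF uC]], of x]
          by (meson mult_right_mono norm_ge_zero order_trans)
        then show ?thesis
          using d(2) unfolding lincomb[OF polyC f] by (simp add: poly scaleC_minus_left dist_norm)
      qed
      then show "\<exists>N. \<forall>n\<ge>N. dist (poly_op A (?p n) x) (\<Phi> f x) < e"
        by blast
    qed
  qed
  then show ?thesis
    by blast
qed

lemma cfc_eq_limit_calculus:
  assumes f: "f \<in> C"
  shows "cfc A f = limit_calculus A f"
  unfolding cfc_def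
proof (rule the_equality)
  show "\<exists>\<Phi>. is_cont_calculus A \<Phi> \<and> limit_calculus A f = \<Phi> f"
    by (rule exI[of _ "limit_calculus A"]) (simp add: is_cont_calculus_limit_calculus)
  show "B = limit_calculus A f" if "\<exists>\<Phi>. is_cont_calculus A \<Phi> \<and> B = \<Phi> f" for B
    using that cont_calculus_unique[OF _ f] by metis
qed

end

section \<open>Real functions of an operator and the inequality\<close>

context real_spectrum_op
begin

abbreviation "real_cont \<phi> \<equiv> continuous_on (Re ` op_spectrum A) \<phi>"

lemma complexified_continuous: "real_cont \<phi> \<Longrightarrow> (\<lambda>z. complex_of_real (\<phi> (Re z))) \<in> C"
  by (auto intro!: continuous_on_of_real continuous_on_compose2[of "Re ` op_spectrum A" \<phi>]
      continuous_intros)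

lemma rcfc_eq_limit_calculus:
  "real_cont \<phi> \<Longrightarrow> rcfc A \<phi> = limit_calculus A (\<lambda>z. complex_of_real (\<phi> (Re z)))"
  unfolding rcfc_def by (rule cfc_eq_limit_calculus[OF complexified_continuous])

lemma rcfc_mult:
  assumes "real_cont \<phi>" "real_cont \<psi>"
  shows "rcfc A \<phi> \<circ> rcfc A \<psi> = rcfc A (\<lambda>t. \<phi> t * \<psi> t)"
  using limit_calculus_mult[OF complexified_continuous complexified_continuous, OF assms]
  by (simp add: fun_eq_iff rcfc_eq_limit_calculus assms continuous_on_mult)

lemma rquad_rcfc_lincomb:
  assumes "real_cont \<phi>" "real_cont \<psi>"
  shows "rquad (rcfc A (\<lambda>t. a * \<phi> t + b * \<psi> t)) x = a * rquad (rcfc A \<phi>) x + b * rquad (rcfc A \<psi>) x"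
  using limit_calculus_lincomb[OF complexified_continuous complexified_continuous, OF assms,
      of "complex_of_real a" "complex_of_real b" x]
  by (simp add: rquad_def rcfc_eq_limit_calculus assms continuous_intros cinner_add_left
      cinner_scaleC_left)

lemma rquad_rcfc_const: "rquad (rcfc A (\<lambda>t. c)) x = c * (norm x)\<^sup>2"
  by (simp add: rquad_def rcfc_eq_limit_calculus limit_calculus_const cinner_scaleC_left cinner_self)

lemma rcfc_ident: "rcfc A (\<lambda>t. t) = A"
proof -
  have "limit_calculus A (\<lambda>z. complex_of_real (Re z)) = limit_calculus A (\<lambda>z. z)"
    by (rule limit_calculus_cong) (use real_spectrum in auto)
  then show ?thesis
    by (simp add: rcfc_eq_limit_calculus limit_calculus_ident)
qed

text \<open>
  A nonnegative \<open>\<phi>\<close> is on the spectrum the square of \<open>s = \<surd>\<bar>\<phi>\<bar>\<close>, which is continuous and real, so that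
  \<open>\<langle>\<phi>(A) x, x\<rangle> = \<langle>s(A) x, s(A) x\<rangle>\<close>.
\<close>
lemma rquad_rcfc_nonneg:
  assumes \<phi>: "real_cont \<phi>" and nonneg: "\<And>t. t \<in> Re ` op_spectrum A \<Longrightarrow> 0 \<le> \<phi> t"
  shows "0 \<le> rquad (rcfc A \<phi>) x"
proof -
  define s where "s z = complex_of_real (sqrt \<bar>\<phi> (Re z)\<bar>)" for z
  have s: "s \<in> C"
    using complexified_continuous[of "\<lambda>t. sqrt \<bar>\<phi> t\<bar>"] \<phi>
    by (simp add: s_def[abs_def] continuous_intros)
  have "limit_calculus A (\<lambda>z. complex_of_real (\<phi> (Re z))) = limit_calculus A (\<lambda>z. s z * s z)"
  proof (rule limit_calculus_cong)
    fix z
    assume "z \<in> op_spectrum A"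
    then have "0 \<le> \<phi> (Re z)"
      using nonneg by blast
    then show "complex_of_real (\<phi> (Re z)) = s z * s z"
      by (simp add: s_def flip: of_real_mult)
  qed
  then have "rcfc A \<phi> x = limit_calculus A s (limit_calculus A s x)"
    using limit_calculus_mult[OF s s] by (simp add: rcfc_eq_limit_calculus[OF \<phi>])
  moreover have "(\<lambda>z. cnj (s z)) = s"
    by (simp add: s_def fun_eq_iff)
  then have "\<langle>limit_calculus A s (limit_calculus A s x), x\<rangle>
      = \<langle>limit_calculus A s x, limit_calculus A s x\<rangle>"
    using limit_calculus_cnj[OF s] unfolding adjoint_pair_def by simp
  ultimately have "rquad (rcfc A \<phi>) x = (norm (limit_calculus A s x))\<^sup>2"
    by (simp add: rquad_def Re_cinner_self)
  then show ?thesis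
    by simp
qed

text \<open>
  Positivity for the functions \<open>t - \<gamma>\<close> and \<open>\<Gamma> - t\<close>.
\<close>
lemma rquad_in_interval:
  assumes "Re ` op_spectrum A \<subseteq> {\<gamma>..\<Gamma>}" and "norm x = 1"
  shows "rquad A x \<in> {\<gamma>..\<Gamma>}"
proof -
  have affine: "rquad (rcfc A (\<lambda>t. a * t + b * 1)) x = a * rquad A x + b" for a b
    using rquad_rcfc_lincomb[of "\<lambda>t. t" "\<lambda>t. 1" a b x] assms(2)
    by (simp add: continuous_on_id rcfc_ident rquad_rcfc_const)
  have "0 \<le> rquad (rcfc A (\<lambda>t. 1 * t + (- \<gamma>) * 1)) x" "0 \<le> rquad (rcfc A (\<lambda>t. (- 1) * t + \<Gamma> * 1)) x"
    using assms(1) by (auto intro!: rquad_rcfc_nonneg continuous_intros)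
  then show ?thesis
    unfolding affine by simp
qed

text \<open>
  For \<open>b\<close>, \<open>c\<close>, \<open>d\<close> the values of \<open>\<eta>\<close>, \<open>\<phi>\<close>, \<open>\<psi>\<close> at a point \<open>s\<close>, the left integrand is the product in
  the definition of synchronous functions, at the points \<open>t\<close> and \<open>s\<close>.
\<close>
lemma rquad_rcfc_product:
  assumes "real_cont \<phi>" "real_cont \<psi>" "real_cont \<eta>"
  shows "rquad (rcfc A (\<lambda>t. (b * \<phi> t - \<eta> t * c) * (b * \<psi> t - \<eta> t * d))) x
    = b\<^sup>2 * rquad (rcfc A \<phi> \<circ> rcfc A \<psi>) x - b * d * rquad (rcfc A \<eta> \<circ> rcfc A \<phi>) x
      - b * c * rquad (rcfc A \<eta> \<circ> rcfc A \<psi>) x + c * d * rquad (rcfc A (\<lambda>t. (\<eta> t)\<^sup>2)) x"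
proof -
  have "(\<lambda>t. (b * \<phi> t - \<eta> t * c) * (b * \<psi> t - \<eta> t * d))
      = (\<lambda>t. 1 * (b\<^sup>2 * (\<phi> t * \<psi> t) + (- (b * d)) * (\<eta> t * \<phi> t))
             + 1 * ((- (b * c)) * (\<eta> t * \<psi> t) + c * d * (\<eta> t)\<^sup>2))"
    by (simp add: fun_eq_iff power2_eq_square algebra_simps)
  moreover have "real_cont (\<lambda>t. \<phi> t * \<psi> t)" "real_cont (\<lambda>t. \<eta> t * \<phi> t)" "real_cont (\<lambda>t. \<eta> t * \<psi> t)"
      "real_cont (\<lambda>t. (\<eta> t)\<^sup>2)"
      "real_cont (\<lambda>t. b\<^sup>2 * (\<phi> t * \<psi> t) + (- (b * d)) * (\<eta> t * \<phi> t))"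
      "real_cont (\<lambda>t. (- (b * c)) * (\<eta> t * \<psi> t) + c * d * (\<eta> t)\<^sup>2)"
    by (intro continuous_intros assms)+
  ultimately show ?thesis
    by (simp only: rquad_rcfc_lincomb rcfc_mult assms) simp
qed

text \<open>
  Freezing one of the two variables at \<open>s\<close> leaves a function that is nonnegative on the spectrum.
\<close>
lemma synchronous_inequality:
  assumes range: "Re ` op_spectrum A \<subseteq> {\<gamma>..\<Gamma>}"
    and cont: "continuous_on {\<gamma>..\<Gamma>} f" "continuous_on {\<gamma>..\<Gamma>} g" "continuous_on {\<gamma>..\<Gamma>} h"
    and sync: "synchronous_on {\<gamma>..\<Gamma>} h f g" and s: "s \<in> {\<gamma>..\<Gamma>}"
  shows "0 \<le> (h s)\<^sup>2 * rquad (rcfc A f \<circ> rcfc A g) x - h s * g s * rquad (rcfc A h \<circ> rcfc A f) x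
      - h s * f s * rquad (rcfc A h \<circ> rcfc A g) x + f s * g s * rquad (rcfc A (\<lambda>t. (h t)\<^sup>2)) x"
proof -
  note cont' = cont[THEN continuous_on_subset, OF range]
  have "0 \<le> rquad (rcfc A (\<lambda>t. (h s * f t - h t * f s) * (h s * g t - h t * g s))) x"
  proof (rule rquad_rcfc_nonneg)
    show "real_cont (\<lambda>t. (h s * f t - h t * f s) * (h s * g t - h t * g s))"
      by (intro continuous_intros cont')
    show "0 \<le> (h s * f t - h t * f s) * (h s * g t - h t * g s)" if "t \<in> Re ` op_spectrum A" for t
      using sync s range that unfolding synchronous_on_def by blast
  qed
  then show ?thesis
    unfolding rquad_rcfc_product[OF cont'] .
qed

text \<open>
  Passing from \<open>g\<close> to \<open>-g\<close> exchanges the two notions.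
\<close>
lemma asynchronous_inequality:
  assumes range: "Re ` op_spectrum A \<subseteq> {\<gamma>..\<Gamma>}"
    and cont: "continuous_on {\<gamma>..\<Gamma>} f" "continuous_on {\<gamma>..\<Gamma>} g" "continuous_on {\<gamma>..\<Gamma>} h"
    and async: "asynchronous_on {\<gamma>..\<Gamma>} h f g" and s: "s \<in> {\<gamma>..\<Gamma>}"
  shows "(h s)\<^sup>2 * rquad (rcfc A f \<circ> rcfc A g) x - h s * g s * rquad (rcfc A h \<circ> rcfc A f) x
      - h s * f s * rquad (rcfc A h \<circ> rcfc A g) x + f s * g s * rquad (rcfc A (\<lambda>t. (h t)\<^sup>2)) x \<le> 0"
proof -
  have "(h u * f t - h t * f u) * (h u * - g t - h t * - g u)
      = - ((h u * f t - h t * f u) * (h u * g t - h t * g u))" for t u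
    by (simp add: algebra_simps)
  then have sync: "synchronous_on {\<gamma>..\<Gamma>} h f (\<lambda>t. - g t)"
    using async by (simp add: synchronous_on_def asynchronous_on_def)
  have "real_cont \<phi> \<Longrightarrow> rquad (rcfc A (\<lambda>t. - \<phi> t)) x = - rquad (rcfc A \<phi>) x" for \<phi>
    using rquad_rcfc_lincomb[of \<phi> \<phi> "-1" 0 x] by simp
  moreover note cont' = cont[THEN continuous_on_subset, OF range]
  ultimately have "rquad (rcfc A \<phi> \<circ> rcfc A (\<lambda>t. - g t)) x = - rquad (rcfc A \<phi> \<circ> rcfc A g) x"
    if "real_cont \<phi>" for \<phi>
    using that by (simp add: rcfc_mult continuous_intros)
  then show ?thesis
    using synchronous_inequality[OF range cont(1) continuous_on_minus[OF cont(2)] cont(3) sync s, of x]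
      cont' by simp
qed

end

theorem theorem2p16:
  fixes A :: "'a::complex_hilbert \<Rightarrow> 'a"
    and \<gamma> \<Gamma> :: real
    and f g h :: "real \<Rightarrow> real"
  assumes "selfadjoint A"
    and "\<gamma> < \<Gamma>"
    and "op_spectrum A \<subseteq> complex_of_real ` {\<gamma>..\<Gamma>}"
    and "continuous_on {\<gamma>..\<Gamma>} h" and "\<forall>t\<in>{\<gamma>..\<Gamma>}. 0 \<le> h t"
    and "continuous_on {\<gamma>..\<Gamma>} f" and "continuous_on {\<gamma>..\<Gamma>} g"
  shows
    "(synchronous_on {\<gamma>..\<Gamma>} h f g \<longrightarrow>
       (\<forall>x. norm x = 1 \<longrightarrow>
          (h (rquad A x))\<^sup>2 * rquad (rcfc A f \<circ> rcfc A g) x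
            - rquad (rcfc A h \<circ> rcfc A f) x * rquad (rcfc A h \<circ> rcfc A g) x
          \<ge> (h (rquad A x) * rquad (rcfc A h \<circ> rcfc A f) x
               - rquad (rcfc A (\<lambda>t. (h t)\<^sup>2)) x * f (rquad A x)) * g (rquad A x)
            + (h (rquad A x) * f (rquad A x) - rquad (rcfc A h \<circ> rcfc A f) x)
               * rquad (rcfc A h \<circ> rcfc A g) x)) \<and>
     (asynchronous_on {\<gamma>..\<Gamma>} h f g \<longrightarrow>
       (\<forall>x. norm x = 1 \<longrightarrow>
          (h (rquad A x))\<^sup>2 * rquad (rcfc A f \<circ> rcfc A g) x
            - rquad (rcfc A h \<circ> rcfc A f) x * rquad (rcfc A h \<circ> rcfc A g) x
          \<le> (h (rquad A x) * rquad (rcfc A h \<circ> rcfc A f) x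
               - rquad (rcfc A (\<lambda>t. (h t)\<^sup>2)) x * f (rquad A x)) * g (rquad A x)
            + (h (rquad A x) * f (rquad A x) - rquad (rcfc A h \<circ> rcfc A f) x)
               * rquad (rcfc A h \<circ> rcfc A g) x))"
proof -
  interpret real_spectrum_op A
    by unfold_locales (use assms(1,3) in auto)
  have range: "Re ` op_spectrum A \<subseteq> {\<gamma>..\<Gamma>}"
    using assms(3) by auto
  note ineqs = synchronous_inequality[OF range assms(6,7,4)]
    asynchronous_inequality[OF range assms(6,7,4)]
  show ?thesis
  proof (intro conjI impI allI)
    fix x :: 'a
    assume "norm x = 1"
    note mean = rquad_in_interval[OF range this]
    note ineq = ineqs[OF _ mean, of x]
    \<comment> \<open>The product of the two expectations cancels from the two sides.\<close>
    {
      assume "synchronous_on {\<gamma>..\<Gamma>} h f g"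
      from ineq(1)[OF this]
      show "(h (rquad A x))\<^sup>2 * rquad (rcfc A f \<circ> rcfc A g) x
            - rquad (rcfc A h \<circ> rcfc A f) x * rquad (rcfc A h \<circ> rcfc A g) x
          \<ge> (h (rquad A x) * rquad (rcfc A h \<circ> rcfc A f) x
               - rquad (rcfc A (\<lambda>t. (h t)\<^sup>2)) x * f (rquad A x)) * g (rquad A x)
            + (h (rquad A x) * f (rquad A x) - rquad (rcfc A h \<circ> rcfc A f) x)
               * rquad (rcfc A h \<circ> rcfc A g) x"
        by (simp add: algebra_simps)
    next
      assume "asynchronous_on {\<gamma>..\<Gamma>} h f g"
      from ineq(2)[OF this]
      show "(h (rquad A x))\<^sup>2 * rquad (rcfc A f \<circ> rcfc A g) x
            - rquad (rcfc A h \<circ> rcfc A f) x * rquad (rcfc A h \<circ> rcfc A g) x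
          \<le> (h (rquad A x) * rquad (rcfc A h \<circ> rcfc A f) x
               - rquad (rcfc A (\<lambda>t. (h t)\<^sup>2)) x * f (rquad A x)) * g (rquad A x)
            + (h (rquad A x) * f (rquad A x) - rquad (rcfc A h \<circ> rcfc A f) x)
               * rquad (rcfc A h \<circ> rcfc A g) x"
        by (simp add: algebra_simps)
    }
  qed
qed

end
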